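(* Consider the ring-road freeway with $m$ on-ramps and $m$ off-ramps described in the context, with on-ramp arrival rates $\lambda=[\lambda_i]_{i\in[m]}$, routing matrix $R$, and maximum load $\rho=\max_{j\in[m]}\rho_j$. Let $\pi$ be any ramp metering policy. If $\pi$ keeps the freeway under-saturated (i.e. $\limsup_{t\to\infty}\mathbb{E}[Q_i(t)]<\infty$ for all $i\in[m]$) and for at least one point $p$ on each link the long-run crossing rate satisfies, almost surely, $$\limsup_{k\to\infty}\frac{D_{\pi,p}(k\tau)}{k}\le 1,$$ then the demand must satisfy $\rho\le 1$.
   Context: **Network.** $[m]=\{1,\dots,m\}$, $\mathbb{N}_0$ is the set of non-negative integers. A single-lane ring road (the mainline) of finite length $P$ has $m$ on-ramps and $m$ off-ramps, all single-lane, placed alternately and numbered in increasing order along the direction of travel so that off-ramp $i$ comes after on-ramp $i$ (indices are cyclic modulo $m$). Link $i$ is the section of the mainline between on-ramp $i$ and off-ramp $i$. There is a ramp meter at every on-ramp. Arriving vehicles join a point queue co-located with the ramp meter; $Q_i(t)$ is the queue size (number of waiting vehicles) at on-ramp $i$ at time $t$. A ramp metering (RM) policy is a rule by which the ramp meters release vehicles from the queues into the freeway (it may use knowledge of $\lambda$ and $R$). Released vehicles, all of length $L>0$, travel along the acceleration lane (a section of finite length starting at the ramp meter) and the mainline without collisions until they reach their destination off-ramp, where they exit. In particular, each vehicle from on-ramp $i$ with destination off-ramp $k$ uses links $i,i+1,\dots,k$ (cyclically), and each vehicle initially in the network has one of the off-ramps as its destination. **Demand.** Time steps have duration $\tau:=h+(S_0+L)/V_f$,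 where $h>0$ is the safe time headway constant, $S_0>0$ a standstill gap, $V_f>0$ the free flow speed; $\tau$ is the minimum safe time headway between front bumpers of two vehicles moving at speed $V_f$. Vehicles arrive to on-ramp $i$ according to an i.i.d. Bernoulli process with parameter $\lambda_i\in[0,1]$ (at most one arrival per time step), independently across on-ramps. Destinations of arriving vehicles are i.i.d.: a vehicle arriving to on-ramp $i$ exits from off-ramp $j$ with probability $R_{ij}$, $\sum_jR_{ij}=1$. The cumulative routing matrix is $\tilde R=[\tilde R_{ij}]$, where $\tilde R_{ij}$ is the fraction of arrivals at on-ramp $i$ that need to use link $j$ to reach their destination. The load on link $j$ is $\rho_j:=\sum_i\lambda_i\tilde R_{ij}$, and the maximum load is $\rho:=\max_{j\in[m]}\rho_j$. **Crossing counts.** $D_{\pi,p}(k\tau)$, $k\in\mathbb{N}_0$, is the cumulative number of vehicles that have crossed point $p$ on the mainline up to time $k\tau$ under the policy $\pi$. **Under-saturation.** A policy keeps the freeway under-saturated (for given $\lambda,R$) if $\limsup_{t\to\infty}\mathbb{E}[Q_i(t)]<\infty$ for all $i\in[m]$. *)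

theory Defs
  imports "HOL-Probability.Probability" "HOL-Library.Real_Mod"
begin

text \<open>
  Positions on the mainline are real coordinates modulo the perimeter, increasing in the
  direction of travel. On-ramps and off-ramps are numbered \<open>1, \<dots>, num_ramps\<close>;
  \<open>on_pos N i\<close> is the point where traffic from on-ramp \<open>i\<close> enters the mainline, that is, the
  downstream end of its acceleration lane. The meter is at the upstream end of that lane.
\<close>

record network =
  num_ramps :: nat
  perimeter :: real
  on_pos :: "nat \<Rightarrow> real"
  off_pos :: "nat \<Rightarrow> real"
  lane_length :: "nat \<Rightarrow> real"
  vehicle_length :: real
  headway :: real
  standstill_gap :: real
  free_speed :: real

definition ramps :: "network \<Rightarrow> nat set" where
  "ramps N = {1..num_ramps N}"

definition valid_network :: "network \<Rightarrow> bool" where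
  "valid_network N \<longleftrightarrow>
     num_ramps N \<ge> 1 \<and> perimeter N > 0 \<and>
     vehicle_length N > 0 \<and> headway N > 0 \<and> standstill_gap N > 0 \<and> free_speed N > 0 \<and>
     (\<forall>i\<in>ramps N. lane_length N i > 0) \<and>
     (\<forall>i\<in>ramps N. on_pos N i < off_pos N i) \<and>
     (\<forall>i\<in>ramps N. i < num_ramps N \<longrightarrow> off_pos N i < on_pos N (i + 1)) \<and>
     off_pos N (num_ramps N) < on_pos N 1 + perimeter N"

definition time_step :: "network \<Rightarrow> real" where
  "time_step N = headway N + (standstill_gap N + vehicle_length N) / free_speed N"

definition link :: "network \<Rightarrow> nat \<Rightarrow> real set" where
  "link N i = {on_pos N i..off_pos N i}"

text \<open>The links \<open>i, i + 1, \<dots>, k\<close>, cyclically, where \<open>m\<close> is the number of links.\<close>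

definition route_links :: "nat \<Rightarrow> nat \<Rightarrow> nat \<Rightarrow> nat set" where
  "route_links m i k = (if i \<le> k then {i..k} else {i..m} \<union> {1..k})"

definition valid_rates :: "network \<Rightarrow> (nat \<Rightarrow> real) \<Rightarrow> bool" where
  "valid_rates N \<Lambda> \<longleftrightarrow> (\<forall>i\<in>ramps N. 0 \<le> \<Lambda> i \<and> \<Lambda> i \<le> 1)"

definition valid_routing :: "network \<Rightarrow> (nat \<Rightarrow> nat \<Rightarrow> real) \<Rightarrow> bool" where
  "valid_routing N R \<longleftrightarrow>
     (\<forall>i\<in>ramps N. (\<forall>j\<in>ramps N. R i j \<ge> 0) \<and> (\<Sum>j\<in>ramps N. R i j) = 1)"

definition cumulative_routing :: "network \<Rightarrow> (nat \<Rightarrow> nat \<Rightarrow> real) \<Rightarrow> nat \<Rightarrow> nat \<Rightarrow> real" where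
  "cumulative_routing N R i j =
     (\<Sum>k | k \<in> ramps N \<and> j \<in> route_links (num_ramps N) i k. R i k)"

definition link_load :: "network \<Rightarrow> (nat \<Rightarrow> real) \<Rightarrow> (nat \<Rightarrow> nat \<Rightarrow> real) \<Rightarrow> nat \<Rightarrow> real" where
  "link_load N \<Lambda> R j = (\<Sum>i\<in>ramps N. \<Lambda> i * cumulative_routing N R i j)"

definition max_load :: "network \<Rightarrow> (nat \<Rightarrow> real) \<Rightarrow> (nat \<Rightarrow> nat \<Rightarrow> real) \<Rightarrow> real" where
  "max_load N \<Lambda> R = Max (link_load N \<Lambda> R ` ramps N)"

text \<open>
  \<open>Initial n\<close> is a vehicle already present at time 0, in a queue or on the freeway;
  \<open>Arrival i k\<close> is the vehicle that joins queue \<open>i\<close> in time step \<open>k\<close>, at time \<open>k\<tau>\<close>.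
\<close>

datatype vehicle = Initial nat | Arrival nat nat

text \<open>
  How a vehicle enters the picture: waiting in a queue; or, only for vehicles on the freeway at
  time 0, with front bumper at coordinate \<open>x\<close>, either having come through on-ramp \<open>i\<close> and
  possibly still having (part of) its body on the acceleration lane (\<open>OnLane i x\<close>), or wholly
  on the mainline (\<open>OnMain x\<close>).
\<close>

datatype entry = Queued nat | OnLane nat real | OnMain real

text \<open>
  \<open>entry_time\<close> is the release time for vehicles in a queue (\<open>\<infinity>\<close> if never released) and 0 for
  vehicles initially on the freeway. \<open>front v t\<close> is the unrolled coordinate of the front bumper
  (not reduced modulo the perimeter), so coordinates below \<open>on_pos N i\<close> of a vehicle
  coming through on-ramp \<open>i\<close> are on the acceleration lane; it is meaningful only from the
  entry time on. \<open>destination i k\<close> matters only if there is an arrival. \<open>seed\<close> is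
  randomness private to the metering policy.
\<close>

record 'w process =
  arrival :: "nat \<Rightarrow> nat \<Rightarrow> 'w \<Rightarrow> bool"
  destination :: "nat \<Rightarrow> nat \<Rightarrow> 'w \<Rightarrow> nat"
  initial_ids :: "'w \<Rightarrow> nat set"
  initial_entry :: "nat \<Rightarrow> 'w \<Rightarrow> entry"
  initial_dest :: "nat \<Rightarrow> 'w \<Rightarrow> nat"
  entry_time :: "vehicle \<Rightarrow> 'w \<Rightarrow> ereal"
  front :: "vehicle \<Rightarrow> real \<Rightarrow> 'w \<Rightarrow> real"
  seed :: "'w \<Rightarrow> real"

definition vehicles :: "network \<Rightarrow> 'w process \<Rightarrow> 'w \<Rightarrow> vehicle set" where
  "vehicles N X \<omega> = Initial ` initial_ids X \<omega> \<union> {Arrival i k | i k. i \<in> ramps N \<and> arrival X i k \<omega>}"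

fun arrival_time :: "network \<Rightarrow> vehicle \<Rightarrow> real" where
  "arrival_time N (Initial n) = 0"
| "arrival_time N (Arrival i k) = real k * time_step N"

fun entry_of :: "'w process \<Rightarrow> vehicle \<Rightarrow> 'w \<Rightarrow> entry" where
  "entry_of X (Initial n) \<omega> = initial_entry X n \<omega>"
| "entry_of X (Arrival i k) \<omega> = Queued i"

fun dest_of :: "'w process \<Rightarrow> vehicle \<Rightarrow> 'w \<Rightarrow> nat" where
  "dest_of X (Initial n) \<omega> = initial_dest X n \<omega>"
| "dest_of X (Arrival i k) \<omega> = destination X i k \<omega>"

text \<open>Front bumper coordinate at the entry time; for queued vehicles, the location of the meter.\<close>

fun entry_coord :: "network \<Rightarrow> entry \<Rightarrow> real" where
  "entry_coord N (Queued i) = on_pos N i - lane_length N i"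
| "entry_coord N (OnLane i x) = x"
| "entry_coord N (OnMain x) = x"

text \<open>The coordinate from which on the front bumper is on the mainline.\<close>

fun main_coord :: "network \<Rightarrow> entry \<Rightarrow> real" where
  "main_coord N (Queued i) = on_pos N i"
| "main_coord N (OnLane i x) = max (on_pos N i) x"
| "main_coord N (OnMain x) = x"

fun valid_entry :: "network \<Rightarrow> entry \<Rightarrow> bool" where
  "valid_entry N (Queued i) \<longleftrightarrow> i \<in> ramps N"
| "valid_entry N (OnLane i x) \<longleftrightarrow> i \<in> ramps N \<and>
     on_pos N i - lane_length N i \<le> x \<and> x \<le> on_pos N i + vehicle_length N"
| "valid_entry N (OnMain x) \<longleftrightarrow> True"

text \<open>
  The unrolled coordinate where the vehicle exits: the first copy of its destination off-ramp
  at or after the point from which on it uses the mainline.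
\<close>

definition exit_coord :: "network \<Rightarrow> 'w process \<Rightarrow> vehicle \<Rightarrow> 'w \<Rightarrow> real" where
  "exit_coord N X v \<omega> =
     (let y = main_coord N (entry_of X v \<omega>)
      in y + (off_pos N (dest_of X v \<omega>) - y) rmod perimeter N)"

datatype road_point = LanePoint nat real | MainPoint real

fun location :: "network \<Rightarrow> entry \<Rightarrow> real \<Rightarrow> road_point" where
  "location N (Queued i) z =
     (if z < on_pos N i then LanePoint i z else MainPoint (z rmod perimeter N))"
| "location N (OnLane i x) z =
     (if z < on_pos N i then LanePoint i z else MainPoint (z rmod perimeter N))"
| "location N (OnMain x) z = MainPoint (z rmod perimeter N)"

definition body :: "network \<Rightarrow> 'w process \<Rightarrow> vehicle \<Rightarrow> real \<Rightarrow> 'w \<Rightarrow> road_point set" where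
  "body N X v t \<omega> =
     location N (entry_of X v \<omega>) ` {front X v t \<omega> - vehicle_length N<..front X v t \<omega>}"

definition on_freeway :: "network \<Rightarrow> 'w process \<Rightarrow> real \<Rightarrow> 'w \<Rightarrow> vehicle set" where
  "on_freeway N X t \<omega> =
     {v \<in> vehicles N X \<omega>. entry_time X v \<omega> \<le> ereal t \<and> front X v t \<omega> < exit_coord N X v \<omega>}"

definition valid_paths :: "network \<Rightarrow> 'w process \<Rightarrow> 'w \<Rightarrow> bool" where
  "valid_paths N X \<omega> \<longleftrightarrow>
     finite (initial_ids X \<omega>) \<and>
     (\<forall>v\<in>vehicles N X \<omega>.
        valid_entry N (entry_of X v \<omega>) \<and> dest_of X v \<omega> \<in> ramps N \<and>
        (case entry_of X v \<omega> of
           Queued i \<Rightarrow> ereal (arrival_time N v) \<le> entry_time X v \<omega>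
         | _ \<Rightarrow> entry_time X v \<omega> = 0) \<and>
        (\<forall>T. entry_time X v \<omega> = ereal T \<longrightarrow>
           front X v T \<omega> = entry_coord N (entry_of X v \<omega>) \<and>
           continuous_on {T..} (\<lambda>t. front X v t \<omega>) \<and>
           mono_on {T..} (\<lambda>t. front X v t \<omega>) \<and>
           (\<forall>t\<ge>T. front X v t \<omega> \<le> exit_coord N X v \<omega>))) \<and>
     (\<forall>t\<ge>0. \<forall>v\<in>on_freeway N X t \<omega>. \<forall>w\<in>on_freeway N X t \<omega>.
        v \<noteq> w \<longrightarrow> body N X v t \<omega> \<inter> body N X w t \<omega> = {})"

definition queue_length :: "network \<Rightarrow> 'w process \<Rightarrow> nat \<Rightarrow> real \<Rightarrow> 'w \<Rightarrow> nat" where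
  "queue_length N X i t \<omega> =
     card {v \<in> vehicles N X \<omega>. entry_of X v \<omega> = Queued i \<and>
             arrival_time N v \<le> t \<and> ereal t < entry_time X v \<omega>}"

text \<open>The number of vehicles whose front bumper has reached the mainline point \<open>p\<close> by time \<open>t\<close>.\<close>

definition crossings :: "network \<Rightarrow> 'w process \<Rightarrow> real \<Rightarrow> real \<Rightarrow> 'w \<Rightarrow> nat" where
  "crossings N X p t \<omega> =
     card {v \<in> vehicles N X \<omega>. entry_time X v \<omega> \<le> ereal t \<and>
             (\<exists>n::int. main_coord N (entry_of X v \<omega>) \<le> p + of_int n * perimeter N \<and>
                       p + of_int n * perimeter N \<le> front X v t \<omega>)}"

definition demand_index :: "network \<Rightarrow> (nat \<times> nat + nat \<times> nat) set" where
  "demand_index N = (ramps N \<times> UNIV) <+> (ramps N \<times> UNIV)"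

fun demand_var :: "'w process \<Rightarrow> nat \<times> nat + nat \<times> nat \<Rightarrow> 'w \<Rightarrow> nat" where
  "demand_var X (Inl (i, k)) \<omega> = of_bool (arrival X i k \<omega>)"
| "demand_var X (Inr (i, k)) \<omega> = destination X i k \<omega>"

definition demand_process ::
  "network \<Rightarrow> (nat \<Rightarrow> real) \<Rightarrow> (nat \<Rightarrow> nat \<Rightarrow> real) \<Rightarrow> 'w measure \<Rightarrow> 'w process \<Rightarrow> bool" where
  "demand_process N \<Lambda> R M X \<longleftrightarrow>
     prob_space.indep_vars M (\<lambda>_. count_space UNIV) (demand_var X) (demand_index N) \<and>
     (\<forall>i\<in>ramps N. \<forall>k.
        measure M {\<omega> \<in> space M. arrival X i k \<omega>} = \<Lambda> i \<and>
        (\<forall>j\<in>ramps N. measure M {\<omega> \<in> space M. destination X i k \<omega> = j} = R i j))"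

definition traffic_process :: "network \<Rightarrow> 'w measure \<Rightarrow> 'w process \<Rightarrow> bool" where
  "traffic_process N M X \<longleftrightarrow>
     (\<forall>\<omega>\<in>space M. valid_paths N X \<omega>) \<and>
     (\<forall>i\<in>ramps N. \<forall>t\<ge>0. queue_length N X i t \<in> measurable M (count_space UNIV))"

datatype status = Absent | Waiting nat nat | Travelling road_point nat

text \<open>
  The state of a vehicle, with its destination, immediately before the release decisions at
  time \<open>t\<close>: a vehicle released at time \<open>t\<close> is still shown as waiting.
\<close>

definition status_before :: "network \<Rightarrow> 'w process \<Rightarrow> 'w \<Rightarrow> real \<Rightarrow> vehicle \<Rightarrow> status" where
  "status_before N X \<omega> t v =
     (if v \<notin> vehicles N X \<omega> \<or> t < arrival_time N v then Absent
      else (case entry_of X v \<omega> of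
              Queued i \<Rightarrow>
                if ereal t \<le> entry_time X v \<omega> then Waiting i (dest_of X v \<omega>)
                else if v \<in> on_freeway N X t \<omega>
                then Travelling (location N (Queued i) (front X v t \<omega>)) (dest_of X v \<omega>)
                else Absent
            | e \<Rightarrow>
                if v \<in> on_freeway N X t \<omega>
                then Travelling (location N e (front X v t \<omega>)) (dest_of X v \<omega>)
                else Absent))"

definition history :: "network \<Rightarrow> 'w process \<Rightarrow> 'w \<Rightarrow> real \<Rightarrow> real \<Rightarrow> vehicle \<Rightarrow> status" where
  "history N X \<omega> t = (\<lambda>s. if s \<le> t then status_before N X \<omega> s else (\<lambda>_. Absent))"

text \<open>
  A policy maps the arrival rates, the routing matrix, a random seed, the current time, the
  history of the network up to that time and an on-ramp to the set of vehicles to be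
  released there at that time. Deterministic policies ignore the seed.
\<close>

type_synonym policy =
  "(nat \<Rightarrow> real) \<Rightarrow> (nat \<Rightarrow> nat \<Rightarrow> real) \<Rightarrow> real \<Rightarrow> real \<Rightarrow> (real \<Rightarrow> vehicle \<Rightarrow> status) \<Rightarrow>
   nat \<Rightarrow> vehicle set"

definition operates_under ::
  "network \<Rightarrow> (nat \<Rightarrow> real) \<Rightarrow> (nat \<Rightarrow> nat \<Rightarrow> real) \<Rightarrow> 'w measure \<Rightarrow> policy \<Rightarrow> 'w process \<Rightarrow> bool" where
  "operates_under N \<Lambda> R M \<pi> X \<longleftrightarrow>
     seed X \<in> borel_measurable M \<and>
     prob_space.indep_set M
       (sets (vimage_algebra (space M) (seed X) borel))
       (sets (vimage_algebra (space M) (\<lambda>\<omega>. \<lambda>e\<in>demand_index N. demand_var X e \<omega>)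
                (PiM (demand_index N) (\<lambda>_. count_space UNIV)))) \<and>
     (\<forall>\<omega>\<in>space M. \<forall>t\<ge>0. \<forall>i\<in>ramps N. \<forall>v d.
        status_before N X \<omega> t v = Waiting i d \<longrightarrow>
        (entry_time X v \<omega> = ereal t \<longleftrightarrow> v \<in> \<pi> \<Lambda> R (seed X \<omega>) t (history N X \<omega> t) i))"

text \<open>
  The expectation is taken in \<open>ennreal\<close>, since the Bochner integral of a non-integrable
  queue length would be 0 rather than infinite.
\<close>

definition under_saturated :: "network \<Rightarrow> 'w measure \<Rightarrow> 'w process \<Rightarrow> bool" where
  "under_saturated N M X \<longleftrightarrow>
     (\<forall>i\<in>ramps N.
        Limsup at_top (\<lambda>t::real. \<integral>\<^sup>+\<omega>. of_nat (queue_length N X i t \<omega>) \<partial>M) < (\<infinity> :: ennreal))"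

end

theory Submission
  imports Defs
begin

text \<open>
  A vehicle that arrives by time \<open>k\<tau>\<close> and has to use link \<open>j\<close> is, at time \<open>k\<tau>\<close>, still queued, or
  still on the freeway, or has crossed the given point of link \<open>j\<close>. Since bodies are disjoint, the
  number of vehicles on the freeway is bounded by a constant \<open>B\<close>. So the number of such arrivals,
  of mean \<open>k\<rho>\<^sub>j\<close>, is at most crossings \<open>+\<close> queues \<open>+ B\<close>. Dividing by \<open>k\<close>, the queues and \<open>B\<close> vanish
  in the mean, and as arrivals per step are bounded by \<open>m\<close>, Fatou's lemma transfers the almost sure
  bound on the crossing rate to the means, without any law of large numbers.
\<close>

section \<open>Limit argument for mean rates\<close>

text \<open>The nonnegative variables \<open>z k = c - A k / k + B / k + Q k / k\<close> have liminf
  at least \<open>c - 1\<close> almost surely, while their means are eventually at most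
  \<open>c - r + (B + C) / k\<close>. Fatou's lemma then gives
  \<open>c - 1 \<le> c - r\<close>.\<close>

lemma (in prob_space) rate_le_1_if_dominated:
  fixes A Q D :: "nat \<Rightarrow> 'a \<Rightarrow> real" and c B C r :: real
  assumes A: "\<And>k. A k \<in> borel_measurable M" "\<And>k \<omega>. 0 \<le> A k \<omega>" "\<And>k \<omega>. A k \<omega> \<le> c * real k"
    and EA: "\<And>k. expectation (A k) = real k * r"
    and Q: "\<And>k. Q k \<in> borel_measurable M" "\<And>k \<omega>. 0 \<le> Q k \<omega>"
    and EQ: "\<forall>\<^sub>F k in sequentially. (\<integral>\<^sup>+\<omega>. ennreal (Q k \<omega>) \<partial>M) \<le> ennreal C"
    and D: "AE \<omega> in M. limsup (\<lambda>k. ereal (D k \<omega> / real k)) \<le> 1"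
    and dom: "\<And>k \<omega>. \<omega> \<in> space M \<Longrightarrow> A k \<omega> \<le> D k \<omega> + Q k \<omega> + B"
    and "1 \<le> c" "0 \<le> B" "0 \<le> C"
  shows "r \<le> 1"
proof -
  \<comment> \<open>The shift by \<open>c\<close> makes the integrands nonnegative, as Fatou's lemma
    in \<open>ennreal\<close> demands. At \<open>k = 0\<close> all quotients are 0 by convention, so
    nonnegativity holds there too.\<close>
  define a where "a k \<omega> = c - A k \<omega> / real k + B / real k" for k \<omega>
  define z where "z k \<omega> = a k \<omega> + Q k \<omega> / real k" for k \<omega>
  have a_nonneg: "0 \<le> a k \<omega>" for k \<omega>
  proof -
    have "A k \<omega> / real k \<le> c"
      using A(3)[of k \<omega>] \<open>1 \<le> c\<close> by (cases "k = 0") (auto simp: field_simps)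
    then show ?thesis
      using \<open>0 \<le> B\<close> by (simp add: a_def add_nonneg_nonneg)
  qed
  have z_nonneg: "0 \<le> z k \<omega>" for k \<omega>
    using a_nonneg Q(2) by (simp add: z_def)
  have [measurable]: "a k \<in> borel_measurable M" "z k \<in> borel_measurable M" for k
    using A(1) Q(1) unfolding a_def[abs_def] z_def[abs_def] by measurable
  have intA: "integrable M (A k)" for k
    using A by (intro integrable_const_bound[of _ "c * real k"]) auto
  \<comment> \<open>With \<open>r \<le> c\<close>, the value \<open>ennreal (c - r)\<close> is not
    truncated to 0, so the final inequality between \<open>ennreal\<close> values can be read back
    in the reals.\<close>
  have "r = expectation (A 1)"
    using EA[of 1] by simp
  also have "\<dots> \<le> expectation (\<lambda>_. c)"
    using A(3)[of 1] intA by (intro integral_mono) auto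
  finally have "r \<le> c"
    by (simp add: prob_space)
  \<comment> \<open>Domination yields \<open>z k \<ge> c - D k / k\<close>. For any
    \<open>s < c - 1\<close> the limsup of \<open>D k / k\<close> is below \<open>c - s\<close>,
    hence eventually \<open>z k > s\<close>.\<close>
  have lower: "AE \<omega> in M. ennreal (c - 1) \<le> liminf (\<lambda>k. ennreal (z k \<omega>))"
    using D AE_space
  proof eventually_elim
    case (elim \<omega>)
    show ?case
      unfolding le_Liminf_iff
    proof (intro allI impI)
      fix y assume y: "y < ennreal (c - 1)"
      then obtain s where s: "y = ennreal s" "0 \<le> s"
        by (cases y) auto
      with y \<open>1 \<le> c\<close> have "s < c - 1"
        by (simp add: ennreal_less_iff)
      then have "limsup (\<lambda>k. ereal (D k \<omega> / real k)) < ereal (c - s)"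
        using elim(1) by (auto intro: order.strict_trans1 simp: one_ereal_def)
      from Limsup_lessD[OF this] eventually_gt_at_top[of 0]
      show "\<forall>\<^sub>F k in sequentially. y < ennreal (z k \<omega>)"
      proof eventually_elim
        case (elim k)
        have "A k \<omega> / real k \<le> (D k \<omega> + Q k \<omega> + B) / real k"
          using dom[OF \<open>\<omega> \<in> space M\<close>] by (simp add: divide_right_mono)
        then have "s < z k \<omega>"
          using elim(1) by (simp add: z_def a_def add_divide_distrib)
        then show ?case
          using s by (simp add: ennreal_lessI)
      qed
    qed
  qed
  \<comment> \<open>Only the part \<open>a k\<close> becomes a Bochner expectation; the queue term
    remains a nonnegative integral, of size at most \<open>C / k\<close>.\<close>
  have upper: "\<forall>\<^sub>F k in sequentially.
      (\<integral>\<^sup>+\<omega>. ennreal (z k \<omega>) \<partial>M) \<le> ennreal (c - r + (B + C) / real k)"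
    using EQ eventually_gt_at_top[of 0]
  proof eventually_elim
    case (elim k)
    have "(\<integral>\<^sup>+\<omega>. ennreal (z k \<omega>) \<partial>M)
        = (\<integral>\<^sup>+\<omega>. ennreal (a k \<omega>) \<partial>M) + (\<integral>\<^sup>+\<omega>. ennreal (1 / real k) * ennreal (Q k \<omega>) \<partial>M)"
      using a_nonneg Q by (subst nn_integral_add[symmetric])
        (auto simp: z_def ennreal_mult[symmetric] simp del: ennreal_plus
              simp flip: ennreal_plus)
    also have "(\<integral>\<^sup>+\<omega>. ennreal (a k \<omega>) \<partial>M) = ennreal (expectation (a k))"
      unfolding a_def[abs_def] using intA a_nonneg[unfolded a_def]
      by (intro nn_integral_eq_integral) auto
    also have "expectation (a k) = c - r + B / real k"
      unfolding a_def[abs_def] using intA EA[of k] elim(2) by (simp add: prob_space)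
    also have "(\<integral>\<^sup>+\<omega>. ennreal (1 / real k) * ennreal (Q k \<omega>) \<partial>M)
        = ennreal (1 / real k) * (\<integral>\<^sup>+\<omega>. ennreal (Q k \<omega>) \<partial>M)"
      using Q(1) by (intro nn_integral_cmult) auto
    also have "\<dots> \<le> ennreal (1 / real k) * ennreal C"
      using elim(1) by (intro mult_left_mono) auto
    also have "\<dots> = ennreal (C / real k)"
      using \<open>0 \<le> C\<close> by (simp add: ennreal_mult[symmetric])
    also have "ennreal (c - r + B / real k) + ennreal (C / real k)
        = ennreal (c - r + (B + C) / real k)"
      using \<open>r \<le> c\<close> \<open>0 \<le> B\<close> \<open>0 \<le> C\<close>
      by (simp add: ennreal_plus[symmetric] add_divide_distrib add.assoc del: ennreal_plus)
    finally show ?case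
      by (simp add: add_left_mono)
  qed
  have "(\<lambda>k. ennreal (c - r + (B + C) / real k)) \<longlonglongrightarrow> ennreal (c - r + 0)"
    by (intro tendsto_ennrealI tendsto_add tendsto_const lim_const_over_n)
  then have lim: "liminf (\<lambda>k. ennreal (c - r + (B + C) / real k)) = ennreal (c - r)"
    by (simp add: lim_imp_Liminf)
  have "ennreal (c - 1) = (\<integral>\<^sup>+\<omega>. ennreal (c - 1) \<partial>M)"
    by (simp add: emeasure_space_1)
  also have "\<dots> \<le> (\<integral>\<^sup>+\<omega>. liminf (\<lambda>k. ennreal (z k \<omega>)) \<partial>M)"
    using lower by (intro nn_integral_mono_AE) auto
  also have "\<dots> \<le> liminf (\<lambda>k. \<integral>\<^sup>+\<omega>. ennreal (z k \<omega>) \<partial>M)"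
    by (intro nn_integral_liminf) auto
  also have "\<dots> \<le> ennreal (c - r)"
    unfolding lim[symmetric] using upper by (rule Liminf_mono)
  finally show "r \<le> 1"
    using \<open>r \<le> c\<close> by simp
qed

section \<open>Order of the ramps and routes along the ring\<close>

text \<open>\<open>valid_network\<close> compares neighbouring ramps only; induction on the
  downstream index chains these comparisons.\<close>

lemma off_pos_less_on_pos:
  assumes N: "valid_network N" and "1 \<le> i" "i < k" "k \<le> num_ramps N"
  shows "off_pos N i < on_pos N k"
  using assms(3,4)
proof (induction k)
  case (Suc k)
  show ?case
  proof (cases "k = i")
    case True
    then show ?thesis
      using N Suc.prems \<open>1 \<le> i\<close> by (auto simp: valid_network_def ramps_def)
  next
    case False
    then have "off_pos N i < on_pos N k"
      using Suc by simp
    also have "\<dots> < off_pos N k"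
      using N Suc.prems \<open>1 \<le> i\<close> by (auto simp: valid_network_def ramps_def)
    also have "\<dots> < on_pos N (Suc k)"
      using N Suc.prems \<open>1 \<le> i\<close> by (auto simp: valid_network_def ramps_def)
    finally show ?thesis .
  qed
qed simp

lemma on_pos_less_off_pos:
  "valid_network N \<Longrightarrow> i \<in> ramps N \<Longrightarrow> on_pos N i < off_pos N i"
  by (simp add: valid_network_def)

lemma on_pos_mono:
  assumes "valid_network N" "1 \<le> i" "i \<le> k" "k \<le> num_ramps N"
  shows "on_pos N i \<le> on_pos N k"
  using off_pos_less_on_pos[OF assms(1,2) _ assms(4)] on_pos_less_off_pos[OF assms(1), of i] assms
  by (cases "i = k") (auto simp: ramps_def)

lemma off_pos_mono:
  assumes "valid_network N" "1 \<le> i" "i \<le> k" "k \<le> num_ramps N"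
  shows "off_pos N i \<le> off_pos N k"
  using off_pos_less_on_pos[OF assms(1,2) _ assms(4)] on_pos_less_off_pos[OF assms(1), of k] assms
  by (cases "i = k") (auto simp: ramps_def)

text \<open>By monotonicity the extreme case is the last off-ramp against the first on-ramp, which
  is the closing condition of \<open>valid_network\<close>.\<close>

lemma off_pos_less_on_pos_plus_perimeter:
  assumes N: "valid_network N" and i: "i \<in> ramps N" and k: "k \<in> ramps N"
  shows "off_pos N k < on_pos N i + perimeter N"
proof -
  have "off_pos N k \<le> off_pos N (num_ramps N)" "on_pos N 1 \<le> on_pos N i"
    using i k by (auto intro: off_pos_mono[OF N] on_pos_mono[OF N] simp: ramps_def)
  then show ?thesis
    using N by (simp add: valid_network_def)
qed

text \<open>The offset from on-ramp \<open>i\<close> to off-ramp \<open>k\<close> lies strictly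
  between 0 and the perimeter if \<open>i \<le> k\<close>, and strictly between minus the perimeter
  and 0 otherwise. So \<open>rmod\<close> adds nothing or exactly one perimeter.\<close>

lemma exit_coord_queued:
  assumes N: "valid_network N" and i: "i \<in> ramps N" and k: "k \<in> ramps N"
    and v: "entry_of X v \<omega> = Queued i" "dest_of X v \<omega> = k"
  shows "exit_coord N X v \<omega> = (if i \<le> k then off_pos N k else off_pos N k + perimeter N)"
proof (cases "i \<le> k")
  case True
  then have "on_pos N i < off_pos N k"
    using on_pos_less_off_pos[OF N i] off_pos_mono[OF N, of i k] i k by (auto simp: ramps_def)
  then have "(off_pos N k - on_pos N i) rmod perimeter N = off_pos N k - on_pos N i"
    using off_pos_less_on_pos_plus_perimeter[OF N i k] by (intro rmod_idem) auto
  then show ?thesis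
    using True by (simp add: exit_coord_def v)
next
  case False
  then have "off_pos N k < on_pos N i"
    using off_pos_less_on_pos[OF N] i k by (auto simp: ramps_def)
  moreover have "on_pos N i < off_pos N k + perimeter N"
    using off_pos_less_on_pos_plus_perimeter[OF N k i] on_pos_less_off_pos[OF N i]
      on_pos_less_off_pos[OF N k] by simp
  ultimately have "(off_pos N k - on_pos N i) rmod perimeter N
      = off_pos N k - on_pos N i + perimeter N"
    using N by (intro rmod_unique[of _ _ _ "-1"]) (auto simp: valid_network_def)
  then show ?thesis
    using False by (simp add: exit_coord_def v)
qed

text \<open>Supplies the integer that \<open>crossings\<close> asks for, once the front has reached
  the exit coordinate.\<close>

lemma route_passes_link_point:
  assumes N: "valid_network N" and i: "i \<in> ramps N" and k: "k \<in> ramps N"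
    and j: "j \<in> ramps N" "j \<in> route_links (num_ramps N) i k" and p: "p \<in> link N j"
    and v: "entry_of X v \<omega> = Queued i" "dest_of X v \<omega> = k"
  obtains n :: int where "on_pos N i \<le> p + of_int n * perimeter N"
    "p + of_int n * perimeter N \<le> exit_coord N X v \<omega>"
proof -
  note exit = exit_coord_queued[OF N i k v]
  have p': "on_pos N j \<le> p" "p \<le> off_pos N j"
    using p by (auto simp: link_def)
  \<comment> \<open>A route that does not wrap around; a wrapping route with link \<open>j\<close>
    before the numbering restarts; a wrapping route with link \<open>j\<close> after it. Only the
    last needs the next-lap copy of \<open>p\<close>, that is \<open>n = 1\<close>.\<close>
  consider "i \<le> j" "j \<le> k" | "k < i" "i \<le> j" | "k < i" "j \<le> k"
    using j by (auto simp: route_links_def split: if_splits)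
  then show ?thesis
  proof cases
    case 1
    then have "on_pos N i \<le> on_pos N j" "off_pos N j \<le> off_pos N k"
      using i j k by (auto intro: on_pos_mono[OF N] off_pos_mono[OF N] simp: ramps_def)
    then show ?thesis
      using 1 p' by (intro that[of 0]) (auto simp: exit)
  next
    case 2
    then have "on_pos N i \<le> on_pos N j"
      using i j by (auto intro: on_pos_mono[OF N] simp: ramps_def)
    moreover have "off_pos N j < off_pos N k + perimeter N"
      using off_pos_less_on_pos_plus_perimeter[OF N k j(1)] on_pos_less_off_pos[OF N k] by simp
    ultimately show ?thesis
      using 2 p' by (intro that[of 0]) (auto simp: exit)
  next
    case 3
    then have "off_pos N j \<le> off_pos N k"
      using j k by (auto intro: off_pos_mono[OF N] simp: ramps_def)
    moreover have "on_pos N i < on_pos N j + perimeter N"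
      using off_pos_less_on_pos_plus_perimeter[OF N j(1) i] on_pos_less_off_pos[OF N i] by simp
    ultimately show ?thesis
      using 3 p' by (intro that[of 1]) (auto simp: exit)
  qed
qed

section \<open>Bounds on the number of vehicles\<close>

text \<open>Path validity says this for queued vehicles. Any other entry belongs to an
  \<open>Initial\<close> vehicle, for which both times are 0.\<close>

lemma arrival_time_le_entry_time:
  assumes "valid_paths N X \<omega>" "v \<in> vehicles N X \<omega>"
  shows "ereal (arrival_time N v) \<le> entry_time X v \<omega>"
proof -
  have *: "case entry_of X v \<omega> of Queued i \<Rightarrow> ereal (arrival_time N v) \<le> entry_time X v \<omega>
      | _ \<Rightarrow> entry_time X v \<omega> = 0"
    using assms by (simp add: valid_paths_def)
  then show ?thesis
    by (cases v) (auto split: entry.splits simp: zero_ereal_def)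
qed

text \<open>The range of possible values of the rounded-down quotient of
  \<open>front - on_pos N i\<close> by the vehicle length: a vehicle from queue \<open>i\<close>
  starts at the meter, \<open>lane_length N i\<close> before the merge, and leaves less than one lap
  after it.\<close>

definition lane_capacity :: "network \<Rightarrow> nat \<Rightarrow> nat" where
  "lane_capacity N i =
     card {\<lfloor>- lane_length N i / vehicle_length N\<rfloor>..\<lfloor>perimeter N / vehicle_length N\<rfloor>}"

text \<open>
  Every body contains exactly one point of the grid of mesh \<open>vehicle_length N\<close> through
  \<open>on_pos N i\<close>, and disjoint bodies contain different grid points.
\<close>

lemma card_on_freeway_le_lane_capacity:
  assumes N: "valid_network N" and paths: "valid_paths N X \<omega>" and "0 \<le> t"
  shows "card {v \<in> on_freeway N X t \<omega>. entry_of X v \<omega> = Queued i} \<le> lane_capacity N i"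
proof -
  let ?V = "{v \<in> on_freeway N X t \<omega>. entry_of X v \<omega> = Queued i}"
  let ?L = "vehicle_length N" and ?a = "on_pos N i"
  \<comment> \<open>\<open>x v\<close> is the last grid point at or before the front. As bodies are
    open at the rear and closed at the front, it lies in the body.\<close>
  define q where "q v = \<lfloor>(front X v t \<omega> - ?a) / ?L\<rfloor>" for v
  define x where "x v = ?a + of_int (q v) * ?L" for v
  have L: "?L > 0" and P: "perimeter N > 0"
    using N by (auto simp: valid_network_def)
  have "location N (Queued i) (x v) \<in> body N X v t \<omega>" if "v \<in> ?V" for v
  proof -
    have "of_int (q v) \<le> (front X v t \<omega> - ?a) / ?L"
      "(front X v t \<omega> - ?a) / ?L < of_int (q v) + 1"
      unfolding q_def by linarith+
    then have "x v \<le> front X v t \<omega>" "front X v t \<omega> - ?L < x v"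
      using L by (auto simp: x_def field_simps)
    then show ?thesis
      using that by (auto simp: body_def)
  qed
  moreover have "body N X v t \<omega> \<inter> body N X w t \<omega> = {}" if "v \<in> ?V" "w \<in> ?V" "v \<noteq> w" for v w
    using paths that \<open>0 \<le> t\<close> by (auto simp: valid_paths_def)
  \<comment> \<open>All these vehicles share the map \<open>location N (Queued i)\<close>, so equal
    indices would give a common point of two disjoint bodies.\<close>
  ultimately have "inj_on q ?V"
    by (intro inj_onI) (metis (no_types, lifting) disjoint_iff x_def)
  moreover have "q ` ?V \<subseteq> {\<lfloor>- lane_length N i / ?L\<rfloor>..\<lfloor>perimeter N / ?L\<rfloor>}"
  proof
    fix y assume "y \<in> q ` ?V"
    then obtain v where v: "v \<in> ?V" and y: "y = q v"
      by blast
    then have vV: "v \<in> vehicles N X \<omega>" and vQ: "entry_of X v \<omega> = Queued i"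
      and vt: "entry_time X v \<omega> \<le> ereal t" and vx: "front X v t \<omega> < exit_coord N X v \<omega>"
      by (auto simp: on_freeway_def)
    from arrival_time_le_entry_time[OF paths vV] vt obtain T where T: "entry_time X v \<omega> = ereal T" "T \<le> t"
      by (cases "entry_time X v \<omega>") auto
    have "front X v T \<omega> = ?a - lane_length N i" "mono_on {T..} (\<lambda>t. front X v t \<omega>)"
      using paths vV vQ T(1) by (auto simp: valid_paths_def)
    then have "- lane_length N i \<le> front X v t \<omega> - ?a"
      using T(2) by (auto dest: mono_onD[of _ _ T t])
    moreover have "exit_coord N X v \<omega> \<le> ?a + perimeter N"
      using rmod_less[OF P] by (simp add: exit_coord_def vQ Let_def less_imp_le)
    ultimately show "y \<in> {\<lfloor>- lane_length N i / ?L\<rfloor>..\<lfloor>perimeter N / ?L\<rfloor>}"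
      using vx L unfolding y q_def atLeastAtMost_iff
      by (intro conjI floor_mono divide_right_mono) auto
  qed
  ultimately show ?thesis
    unfolding lane_capacity_def by (rule card_inj_on_le[OF _ _ finite_atLeastAtMost_int])
qed

text \<open>Makes comparison of cardinalities legitimate, since \<open>card\<close> is 0 on infinite
  sets. There are finitely many initial vehicles, and arrivals by time \<open>t\<close> come from
  finitely many ramps and steps.\<close>

lemma finite_vehicles_arrived:
  assumes N: "valid_network N" and paths: "valid_paths N X \<omega>"
  shows "finite {v \<in> vehicles N X \<omega>. arrival_time N v \<le> t}"
proof -
  have \<tau>: "time_step N > 0"
    using N by (simp add: valid_network_def time_step_def add_pos_pos)
  have "{v \<in> vehicles N X \<omega>. arrival_time N v \<le> t}
      \<subseteq> Initial ` initial_ids X \<omega> \<union> (\<lambda>(i, k). Arrival i k) ` (ramps N \<times> {..nat \<lfloor>t / time_step N\<rfloor>})"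
  proof
    fix v assume v: "v \<in> {v \<in> vehicles N X \<omega>. arrival_time N v \<le> t}"
    show "v \<in> Initial ` initial_ids X \<omega> \<union>
        (\<lambda>(i, k). Arrival i k) ` (ramps N \<times> {..nat \<lfloor>t / time_step N\<rfloor>})"
    proof (cases v)
      case (Initial n)
      then show ?thesis using v by (auto simp: vehicles_def)
    next
      case (Arrival i k)
      then have "i \<in> ramps N" "real k \<le> t / time_step N"
        using v \<tau> by (auto simp: vehicles_def field_simps)
      then show ?thesis
        using Arrival by (auto simp: le_nat_floor)
    qed
  qed
  moreover have "finite (initial_ids X \<omega>)" "finite (ramps N)"
    using paths by (auto simp: valid_paths_def ramps_def)
  ultimately show ?thesis
    by (auto elim: finite_subset)
qed

section \<open>Demand for a link: pathwise bound and mean\<close>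

text \<open>Arrivals in steps \<open>0\<close> to \<open>k - 1\<close> that must use link
  \<open>j\<close>, as a sum of indicators so that the mean is computed slot by slot. Destinations
  are restricted to \<open>ramps N\<close>, the values whose probabilities
  \<open>demand_process\<close> prescribes.\<close>

definition demand_count :: "network \<Rightarrow> 'w process \<Rightarrow> nat \<Rightarrow> nat \<Rightarrow> 'w \<Rightarrow> nat" where
  "demand_count N X j k \<omega> = (\<Sum>i\<in>ramps N. \<Sum>l<k.
     of_bool (arrival X i l \<omega> \<and> destination X i l \<omega> \<in> {d \<in> ramps N. j \<in> route_links (num_ramps N) i d}))"

text \<open>A pathwise bound: the counted arrivals inject into the vehicles that have crossed
  \<open>p\<close>, are queued, or are on the freeway. Initial vehicles can only enlarge the
  right-hand side.\<close>

lemma demand_count_le: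
  assumes N: "valid_network N" and paths: "valid_paths N X \<omega>"
    and j: "j \<in> ramps N" and p: "p \<in> link N j"
  shows "demand_count N X j k \<omega> \<le> crossings N X p (real k * time_step N) \<omega>
     + (\<Sum>i\<in>ramps N. queue_length N X i (real k * time_step N) \<omega>) + (\<Sum>i\<in>ramps N. lane_capacity N i)"
proof -
  have \<tau>: "time_step N > 0"
    using N by (simp add: valid_network_def time_step_def add_pos_pos)
  define t where "t = real k * time_step N"
  have "0 \<le> t"
    using \<tau> by (simp add: t_def)
  have fin: "finite (ramps N)"
    by (simp add: ramps_def)
  define I where "I = {(i, l). i \<in> ramps N \<and> l < k \<and> arrival X i l \<omega> \<and>
    destination X i l \<omega> \<in> ramps N \<and> j \<in> route_links (num_ramps N) i (destination X i l \<omega>)}"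
  let ?V = "vehicles N X \<omega>"
  let ?C = "{v \<in> ?V. entry_time X v \<omega> \<le> ereal t \<and>
    (\<exists>n::int. main_coord N (entry_of X v \<omega>) \<le> p + of_int n * perimeter N \<and>
       p + of_int n * perimeter N \<le> front X v t \<omega>)}"
  let ?Q = "\<lambda>i. {v \<in> ?V. entry_of X v \<omega> = Queued i \<and> arrival_time N v \<le> t \<and> ereal t < entry_time X v \<omega>}"
  let ?F = "\<lambda>i. {v \<in> on_freeway N X t \<omega>. entry_of X v \<omega> = Queued i}"
  have "demand_count N X j k \<omega> = card I"
  proof -
    have "I = (SIGMA i:ramps N. {..<k} \<inter> {l. arrival X i l \<omega> \<and>
        destination X i l \<omega> \<in> {d \<in> ramps N. j \<in> route_links (num_ramps N) i d}})"
      by (auto simp: I_def)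
    then show ?thesis
      using fin by (simp add: demand_count_def)
  qed
  also have "card I = card ((\<lambda>(i, l). Arrival i l) ` I)"
    by (intro card_image[symmetric] inj_onI) auto
  also have "\<dots> \<le> card ((?C \<union> (\<Union>i\<in>ramps N. ?Q i)) \<union> (\<Union>i\<in>ramps N. ?F i))"
  proof (intro card_mono)
    have "finite {v \<in> ?V. arrival_time N v \<le> t}"
      using N paths by (rule finite_vehicles_arrived)
    moreover have "(?C \<union> (\<Union>i\<in>ramps N. ?Q i)) \<union> (\<Union>i\<in>ramps N. ?F i) \<subseteq> {v \<in> ?V. arrival_time N v \<le> t}"
      using arrival_time_le_entry_time[OF paths] by (auto simp: on_freeway_def intro: ereal_less_eq(3)[THEN iffD1] order_trans)
    ultimately show "finite ((?C \<union> (\<Union>i\<in>ramps N. ?Q i)) \<union> (\<Union>i\<in>ramps N. ?F i))"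
      by (rule finite_subset[rotated])
    show "(\<lambda>(i, l). Arrival i l) ` I \<subseteq> (?C \<union> (\<Union>i\<in>ramps N. ?Q i)) \<union> (\<Union>i\<in>ramps N. ?F i)"
    proof
      fix v assume "v \<in> (\<lambda>(i, l). Arrival i l) ` I"
      then obtain i l where v: "v = Arrival i l" and il: "i \<in> ramps N" "l < k" "arrival X i l \<omega>"
        "destination X i l \<omega> \<in> ramps N" "j \<in> route_links (num_ramps N) i (destination X i l \<omega>)"
        by (auto simp: I_def)
      have vV: "v \<in> ?V" and vQ: "entry_of X v \<omega> = Queued i" and vt: "arrival_time N v \<le> t"
        using v il \<tau> by (auto simp: vehicles_def t_def)
      obtain n :: int where n: "on_pos N i \<le> p + of_int n * perimeter N"
        "p + of_int n * perimeter N \<le> exit_coord N X v \<omega>"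
        using route_passes_link_point[OF N il(1,4) j il(5) p vQ] v by auto
      \<comment> \<open>Queued, travelling, or out. In the last case the front is at or past the
        exit coordinate, hence past the copy of \<open>p\<close> given by \<open>n\<close>.\<close>
      consider "ereal t < entry_time X v \<omega>"
        | "entry_time X v \<omega> \<le> ereal t" "front X v t \<omega> < exit_coord N X v \<omega>"
        | "entry_time X v \<omega> \<le> ereal t" "exit_coord N X v \<omega> \<le> front X v t \<omega>"
        by (metis not_le)
      then show "v \<in> (?C \<union> (\<Union>i\<in>ramps N. ?Q i)) \<union> (\<Union>i\<in>ramps N. ?F i)"
      proof cases
        case 1
        then show ?thesis using vV vQ vt il(1) by blast
      next
        case 2
        then show ?thesis using vV vQ il(1) by (auto simp: on_freeway_def)
      next
        case 3
        then have "v \<in> ?C"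
          using vV n by (auto simp: vQ intro!: exI[of _ n])
        then show ?thesis by blast
      qed
    qed
  qed
  also have "\<dots> \<le> (card ?C + (\<Sum>i\<in>ramps N. card (?Q i))) + (\<Sum>i\<in>ramps N. card (?F i))"
    by (intro order_trans[OF card_Un_le] add_mono order_refl card_UN_le fin)
  also have "\<dots> \<le> (card ?C + (\<Sum>i\<in>ramps N. card (?Q i))) + (\<Sum>i\<in>ramps N. lane_capacity N i)"
    using card_on_freeway_le_lane_capacity[OF N paths \<open>0 \<le> t\<close>] by (intro add_left_mono sum_mono)
  finally show ?thesis
    by (simp add: crossings_def queue_length_def t_def)
qed

lemma demand_count_le_linear: "demand_count N X j k \<omega> \<le> num_ramps N * k"
proof -
  have "demand_count N X j k \<omega> \<le> (\<Sum>i\<in>ramps N. \<Sum>l<k. 1)"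
    unfolding demand_count_def by (intro sum_mono) auto
  then show ?thesis
    by (simp add: ramps_def)
qed

text \<open>Linearity reduces the mean to a single slot \<open>(i, l)\<close>, where independence of
  arrival and destination gives the product
  \<open>\<Lambda> i * cumulative_routing N R i j\<close>.\<close>

lemma (in prob_space) demand_count_measurable_and_expectation:
  assumes dem: "demand_process N \<Lambda> R M X"
  shows borel_measurable_demand_count: "(\<lambda>\<omega>. real (demand_count N X j k \<omega>)) \<in> borel_measurable M"
    and expectation_demand_count:
      "expectation (\<lambda>\<omega>. real (demand_count N X j k \<omega>)) = real k * link_load N \<Lambda> R j"
proof -
  define U where "U i = {d \<in> ramps N. j \<in> route_links (num_ramps N) i d}" for i
  define E where "E i l = {\<omega> \<in> space M. arrival X i l \<omega> \<and> destination X i l \<omega> \<in> U i}" for i l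
  have ind: "indep_vars (\<lambda>_. count_space UNIV) (demand_var X) (demand_index N)"
    using dem by (simp add: demand_process_def)
  have E: "E i l \<in> events \<and> prob (E i l) = \<Lambda> i * cumulative_routing N R i j" if i: "i \<in> ramps N" for i l
  proof -
    have idx: "Inl (i, l) \<in> demand_index N" "Inr (i, l) \<in> demand_index N"
      using i by (auto simp: demand_index_def)
    have rv: "demand_var X e \<in> measurable M (count_space UNIV)" if "e \<in> demand_index N" for e
      using ind that by (auto simp: indep_vars_def)
    \<comment> \<open>The target sets for the two coordinates of a slot: value 1 encodes an arrival
      under \<open>Inl\<close>, and \<open>U i\<close> holds the destinations under
      \<open>Inr\<close> whose route uses link \<open>j\<close>.\<close>
    let ?A = "case_sum (\<lambda>_. {1}) (\<lambda>_. U i) :: nat \<times> nat + nat \<times> nat \<Rightarrow> nat set"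
    have a: "demand_var X (Inl (i, l)) -` {1} \<inter> space M = {\<omega> \<in> space M. arrival X i l \<omega>}"
      by (auto simp: of_bool_def split: if_splits)
    have d: "demand_var X (Inr (i, l)) -` S \<inter> space M = {\<omega> \<in> space M. destination X i l \<omega> \<in> S}" for S
      by auto
    have ev_a: "{\<omega> \<in> space M. arrival X i l \<omega>} \<in> events"
      using measurable_sets[OF rv[OF idx(1)], of "{1}"] unfolding a by simp
    have ev_d: "{\<omega> \<in> space M. destination X i l \<omega> \<in> S} \<in> events" for S
      using measurable_sets[OF rv[OF idx(2)], of S] unfolding d by simp
    have E_eq: "E i l = {\<omega> \<in> space M. arrival X i l \<omega>} \<inter> {\<omega> \<in> space M. destination X i l \<omega> \<in> U i}"
      by (auto simp: E_def)
    have "prob (\<Inter>e\<in>{Inl (i, l), Inr (i, l)}. demand_var X e -` ?A e \<inter> space M)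
        = (\<Prod>e\<in>{Inl (i, l), Inr (i, l)}. prob (demand_var X e -` ?A e \<inter> space M))"
      using idx by (intro indep_varsD[OF ind]) auto
    then have "prob (E i l) = prob {\<omega> \<in> space M. arrival X i l \<omega>} * prob {\<omega> \<in> space M. destination X i l \<omega> \<in> U i}"
      by (simp add: a[unfolded One_nat_def] d E_eq del: demand_var.simps)
    also have "prob {\<omega> \<in> space M. destination X i l \<omega> \<in> U i} = (\<Sum>u\<in>U i. prob {\<omega> \<in> space M. destination X i l \<omega> = u})"
    proof -
      have "{\<omega> \<in> space M. destination X i l \<omega> \<in> U i} = (\<Union>u\<in>U i. {\<omega> \<in> space M. destination X i l \<omega> = u})"
        by auto
      moreover have "{\<omega> \<in> space M. destination X i l \<omega> = u} \<in> events" for u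
        using ev_d[of "{u}"] by simp
      ultimately show ?thesis
        by (auto simp: U_def ramps_def disjoint_family_on_def intro!: finite_measure_finite_Union)
    qed
    also have "\<dots> = cumulative_routing N R i j"
      using dem i by (auto simp: demand_process_def U_def cumulative_routing_def intro!: sum.cong)
    finally show ?thesis
      using dem i ev_a ev_d by (auto simp: E_eq demand_process_def)
  qed
  have E_int: "E i l \<inter> space M = E i l" for i l
    by (auto simp: E_def)
  have int: "integrable M (\<lambda>\<omega>. indicator (E i l) \<omega> :: real)" if "i \<in> ramps N" for i l
    using E[OF that] by (intro integrable_real_indicator) (auto simp: less_top[symmetric])
  have eq: "real (demand_count N X j k \<omega>) = (\<Sum>i\<in>ramps N. \<Sum>l<k. indicator (E i l) \<omega>)" if "\<omega> \<in> space M" for \<omega>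
    using that by (auto simp: demand_count_def E_def U_def indicator_def of_bool_def intro!: sum.cong)
  show "(\<lambda>\<omega>. real (demand_count N X j k \<omega>)) \<in> borel_measurable M"
    using E by (subst measurable_cong[OF eq]) (auto intro!: borel_measurable_sum borel_measurable_indicator)
  have "expectation (\<lambda>\<omega>. real (demand_count N X j k \<omega>)) = expectation (\<lambda>\<omega>. \<Sum>i\<in>ramps N. \<Sum>l<k. indicator (E i l) \<omega>)"
    using eq by (intro Bochner_Integration.integral_cong) auto
  also have "\<dots> = (\<Sum>i\<in>ramps N. \<Sum>l<k. prob (E i l))"
    by (simp add: int Bochner_Integration.integral_sum E_int)
  also have "\<dots> = real k * link_load N \<Lambda> R j"
    using E by (simp add: link_load_def sum_distrib_left)
  finally show "expectation (\<lambda>\<omega>. real (demand_count N X j k \<omega>)) = real k * link_load N \<Lambda> R j" .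
qed

section \<open>Conclusion for every link\<close>

theorem theorem4:
  fixes N :: network
    and \<Lambda> :: "nat \<Rightarrow> real"
    and R :: "nat \<Rightarrow> nat \<Rightarrow> real"
    and M :: "'w measure"
    and \<pi> :: policy
    and X :: "'w process"
  assumes "valid_network N" and "valid_rates N \<Lambda>" and "valid_routing N R"
    and "prob_space M"
    and "demand_process N \<Lambda> R M X"
    and "traffic_process N M X"
    and "operates_under N \<Lambda> R M \<pi> X"
    and "under_saturated N M X"
    and "\<forall>j\<in>ramps N. \<exists>p\<in>link N j.
           AE \<omega> in M. limsup (\<lambda>k. ereal (real (crossings N X p (real k * time_step N) \<omega>) / real k)) \<le> 1"
  shows "max_load N \<Lambda> R \<le> 1"
proof -
  interpret prob_space M by fact
  note N = \<open>valid_network N\<close>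
  have paths: "valid_paths N X \<omega>" if "\<omega> \<in> space M" for \<omega>
    using \<open>traffic_process N M X\<close> that by (simp add: traffic_process_def)
  have \<tau>: "time_step N > 0"
    using N by (simp add: valid_network_def time_step_def add_pos_pos)
  have fin: "finite (ramps N)" and ne: "ramps N \<noteq> {}" and m: "1 \<le> num_ramps N"
    using N by (auto simp: valid_network_def ramps_def)
  define Q where "Q k \<omega> = real (\<Sum>i\<in>ramps N. queue_length N X i (real k * time_step N) \<omega>)" for k \<omega>
  have meas: "(\<lambda>\<omega>. real (queue_length N X i (real k * time_step N) \<omega>)) \<in> borel_measurable M"
    if "i \<in> ramps N" for i k
  proof (rule measurable_compose[where g = real])
    show "queue_length N X i (real k * time_step N) \<in> measurable M (count_space UNIV)"
      using \<open>traffic_process N M X\<close> that \<tau> by (simp add: traffic_process_def)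
  qed simp
  have "\<exists>C. \<forall>i\<in>ramps N. 0 \<le> C i \<and> (\<forall>\<^sub>F k in sequentially.
      (\<integral>\<^sup>+\<omega>. of_nat (queue_length N X i (real k * time_step N) \<omega>) \<partial>M) \<le> ennreal (C i))"
  proof (intro bchoice ballI)
    fix i assume "i \<in> ramps N"
    then have "Limsup at_top (\<lambda>t::real. \<integral>\<^sup>+\<omega>. of_nat (queue_length N X i t \<omega>) \<partial>M) < (\<infinity> :: ennreal)"
      using \<open>under_saturated N M X\<close> by (simp add: under_saturated_def)
    \<comment> \<open>A value strictly between the limsup and infinity is finite and bounds the mean
      queue for all large \<open>t\<close>, hence at the sampled times
      \<open>k\<tau>\<close>.\<close>
    then obtain b where b: "Limsup at_top (\<lambda>t::real. \<integral>\<^sup>+\<omega>. of_nat (queue_length N X i t \<omega>) \<partial>M) < b"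
      "b < (\<infinity> :: ennreal)"
      using dense by blast
    obtain c where c: "b = ennreal c" "0 \<le> c"
      using b(2) by (cases b) auto
    have "filterlim (\<lambda>k. real k * time_step N) at_top sequentially"
      using \<tau> by (intro filterlim_at_top_mult_tendsto_pos[OF tendsto_const] filterlim_real_sequentially)
    from eventually_compose_filterlim[OF Limsup_lessD[OF b(1)] this]
    show "\<exists>c. 0 \<le> c \<and> (\<forall>\<^sub>F k in sequentially.
        (\<integral>\<^sup>+\<omega>. of_nat (queue_length N X i (real k * time_step N) \<omega>) \<partial>M) \<le> ennreal c)"
      using c by (auto intro!: exI[of _ c] elim!: eventually_mono)
  qed
  then obtain C where C: "\<And>i. i \<in> ramps N \<Longrightarrow> 0 \<le> C i"
    "\<And>i. i \<in> ramps N \<Longrightarrow> \<forall>\<^sub>F k in sequentially.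
      (\<integral>\<^sup>+\<omega>. of_nat (queue_length N X i (real k * time_step N) \<omega>) \<partial>M) \<le> ennreal (C i)"
    by blast
  have EQ: "\<forall>\<^sub>F k in sequentially. (\<integral>\<^sup>+\<omega>. ennreal (Q k \<omega>) \<partial>M) \<le> ennreal (\<Sum>i\<in>ramps N. C i)"
  proof -
    have "\<forall>\<^sub>F k in sequentially. \<forall>i\<in>ramps N.
        (\<integral>\<^sup>+\<omega>. of_nat (queue_length N X i (real k * time_step N) \<omega>) \<partial>M) \<le> ennreal (C i)"
      using C(2) fin by (simp add: eventually_ball_finite)
    then show ?thesis
    proof eventually_elim
      case (elim k)
      have "(\<integral>\<^sup>+\<omega>. ennreal (Q k \<omega>) \<partial>M)
          = (\<Sum>i\<in>ramps N. \<integral>\<^sup>+\<omega>. of_nat (queue_length N X i (real k * time_step N) \<omega>) \<partial>M)"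
        using meas by (subst nn_integral_sum[symmetric])
          (auto simp: Q_def ennreal_of_nat_eq_real_of_nat sum_ennreal)
      also have "\<dots> \<le> (\<Sum>i\<in>ramps N. ennreal (C i))"
        using elim by (intro sum_mono) auto
      also have "\<dots> = ennreal (\<Sum>i\<in>ramps N. C i)"
        using C(1) by (rule sum_ennreal)
      finally show ?case .
    qed
  qed
  have "link_load N \<Lambda> R j \<le> 1" if j: "j \<in> ramps N" for j
  proof -
    obtain p where p: "p \<in> link N j" and
      D: "AE \<omega> in M. limsup (\<lambda>k. ereal (real (crossings N X p (real k * time_step N) \<omega>) / real k)) \<le> 1"
      using assms(9) j by blast
    show ?thesis
    \<comment> \<open>\<open>c\<close> is the number of ramps because each ramp has at most one
      arrival per step; \<open>B\<close> collects the freeway capacity and \<open>C\<close> the mean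
      queue bounds over all on-ramps.\<close>
    proof (rule rate_le_1_if_dominated[where D = "\<lambda>k. \<lambda>\<omega>. real (crossings N X p (real k * time_step N) \<omega>)"
          and A = "\<lambda>k. \<lambda>\<omega>. real (demand_count N X j k \<omega>)" and Q = Q and c = "real (num_ramps N)"
          and B = "real (\<Sum>i\<in>ramps N. lane_capacity N i)" and C = "\<Sum>i\<in>ramps N. C i"])
      show "real (demand_count N X j k \<omega>) \<le> real (num_ramps N) * real k" for k \<omega>
        using demand_count_le_linear[of N X j k \<omega>] by (simp flip: of_nat_mult)
      show "real (demand_count N X j k \<omega>) \<le> real (crossings N X p (real k * time_step N) \<omega>) + Q k \<omega>
          + real (\<Sum>i\<in>ramps N. lane_capacity N i)" if "\<omega> \<in> space M" for k \<omega>
        using demand_count_le[OF N paths[OF that] j p, of k] unfolding Q_def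
        by (simp flip: of_nat_add of_nat_sum)
      show "Q k \<in> borel_measurable M" for k
        using meas unfolding Q_def[abs_def] by simp
    qed (use D EQ m C(1) borel_measurable_demand_count[OF assms(5)]
           expectation_demand_count[OF assms(5)] in \<open>auto simp: Q_def intro: sum_nonneg\<close>)
  qed
  then show ?thesis
    using fin ne by (simp add: max_load_def)
qed

end
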